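(* Let $j$ and $m$ be even positive integers with $m \leq j$, and let $D = \{1, j, mj\}$. Then $\mu(D) = \kappa(D) = \frac{m}{2(m+1)}$.
   Context: For a set $D$ of positive integers, a $D$-sequence is a set $S$ of nonnegative integers such that $|x-y| \notin D$ for all $x,y \in S$. For $N \geq 0$ write $S[N] = |S \cap \{0,1,\dots,N\}|$. The upper and lower densities of $S$ are $\limsup_{N\to\infty} S[N]/(N+1)$ and $\liminf_{N\to\infty} S[N]/(N+1)$; if they coincide, the common value is the density $\delta(S)$. Define $\mu(D) = \sup\{\delta(S) : S \text{ is a } D\text{-sequence having a density}\}$. For a real $x$, $\|x\|$ denotes the distance from $x$ to the nearest integer, and $\kappa(D) = \sup_{t \in \mathbb{R}} \min_{d \in D} \|td\|$. *)

theory Defs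
  imports Complex_Main "HOL-Library.Extended_Real" "HOL-Library.Liminf_Limsup"
begin

definition D_sequence :: "nat set \<Rightarrow> nat set \<Rightarrow> bool" where
  "D_sequence D S \<longleftrightarrow> (\<forall>x\<in>S. \<forall>y\<in>S. nat \<bar>int x - int y\<bar> \<notin> D)"

definition counting :: "nat set \<Rightarrow> nat \<Rightarrow> nat" where
  "counting S N = card (S \<inter> {0..N})"

definition upper_density :: "nat set \<Rightarrow> ereal" where
  "upper_density S = limsup (\<lambda>N. ereal (real (counting S N) / real (N + 1)))"

definition lower_density :: "nat set \<Rightarrow> ereal" where
  "lower_density S = liminf (\<lambda>N. ereal (real (counting S N) / real (N + 1)))"

definition has_density :: "nat set \<Rightarrow> bool" where
  "has_density S \<longleftrightarrow> lower_density S = upper_density S"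

text \<open>Both densities lie in \<open>[0, 1]\<close>, so passing to a real number loses nothing.
  The value is meaningful only if \<^term>\<open>has_density S\<close>.\<close>

definition seq_density :: "nat set \<Rightarrow> real" where
  "seq_density S = real_of_ereal (upper_density S)"

text \<open>The set below is contained in \<open>[0, 1]\<close>, and it is nonempty since the empty
  set is a \<open>D\<close>-sequence of density \<open>0\<close>; hence the supremum is a genuine one.\<close>

definition mu :: "nat set \<Rightarrow> real" where
  "mu D = Sup {seq_density S | S. D_sequence D S \<and> has_density S}"

definition dist_nearest_int :: "real \<Rightarrow> real" where
  "dist_nearest_int x = \<bar>x - of_int (round x)\<bar>"

text \<open>Intended for finite nonempty \<open>D\<close>, where \<^const>\<open>Min\<close> is meaningful; the values are
  then bounded by \<open>1/2\<close>.\<close>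

definition kappa :: "nat set \<Rightarrow> real" where
  "kappa D = (SUP t::real. Min ((\<lambda>d. dist_nearest_int (t * real d)) ` D))"

end

theory Submission
  imports Defs
begin

text \<open>
  Upper bounds use only the differences \<open>j\<close> and \<open>m j\<close>: the points \<open>x, x + j, \<dots>, x + m j\<close> form an
  odd cycle of length \<open>m + 1\<close> in the conflict graph, so at most \<open>m / 2\<close> of them lie in a
  \<open>D\<close>-sequence, and averaging over \<open>x\<close> bounds the density. For \<open>\<kappa>\<close>, if \<open>t j\<close> is closer than
  \<open>1 / (2 (m + 1))\<close> to a half-integer, then \<open>t m j\<close> is closer than \<open>m / (2 (m + 1))\<close> to an integer.

  Both lower bounds come from \<open>t = 1/2 + m / (2 (m + 1) j)\<close>. With \<open>m = 2 h\<close> and \<open>j = 2 l\<close> this is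
  \<open>t = p / n\<close> for \<open>p = h + (m + 1) l\<close> and \<open>n = (m + 1) j\<close>; the residues of \<open>p d\<close> modulo \<open>n\<close> all lie
  in \<open>[a, n - a]\<close> for \<open>a = h j\<close>, the hypothesis \<open>m \<le> j\<close> being what is needed for \<open>d = 1\<close>. Some
  translate of \<open>{x. p x mod n < a}\<close> is then a \<open>D\<close>-sequence of density at least \<open>a / n\<close>.
\<close>

section \<open>Counting functions and forbidden differences\<close>

lemma counting_eq_sum: "counting S N = (\<Sum>x<Suc N. of_bool (x \<in> S))"
proof -
  have "{0..N} \<inter> {x. x \<in> S} = S \<inter> {0..N}" by auto
  then show ?thesis
    by (simp add: counting_def sum_of_bool_eq lessThan_Suc_atMost atLeast0AtMost)
qed

lemma D_sequenceD:
  assumes "D_sequence D S" "d \<in> D" "x \<in> S"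
  shows "x + d \<notin> S"
proof
  assume "x + d \<in> S"
  then have "nat \<bar>int x - int (x + d)\<bar> \<notin> D"
    using assms unfolding D_sequence_def by blast
  with assms(2) show False by simp
qed

lemma D_sequenceI:
  assumes "\<And>x d. d \<in> D \<Longrightarrow> x \<in> S \<Longrightarrow> x + d \<notin> S"
  shows "D_sequence D S"
  unfolding D_sequence_def
proof (intro ballI notI)
  fix x y assume xy: "x \<in> S" "y \<in> S" and d: "nat \<bar>int x - int y\<bar> \<in> D"
  show False
  proof (cases "x \<le> y")
    case True
    then have "y = x + nat \<bar>int x - int y\<bar>" by simp
    then show False using assms[OF d xy(1)] xy(2) by metis
  next
    case False
    then have "x = y + nat \<bar>int x - int y\<bar>" by simp
    then show False using assms[OF d xy(2)] xy(1) by metis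
  qed
qed

section \<open>Upper bound on the density from odd cycles\<close>

text \<open>Summing over the \<open>2 * h + 1\<close> edges counts every vertex twice, so twice the
  sum is at most \<open>2 * h + 1\<close>; parity then saves the last unit.\<close>

lemma odd_cycle_independent_sum_le:
  fixes f :: "nat \<Rightarrow> nat"
  assumes "\<And>i. i < 2 * h \<Longrightarrow> f i + f (Suc i) \<le> 1" and "f 0 + f (2 * h) \<le> 1"
  shows "(\<Sum>i<Suc (2 * h). f i) \<le> h"
proof -
  have "2 * (\<Sum>i<Suc (2 * h). f i) = (\<Sum>i<2 * h. f i + f (Suc i)) + (f 0 + f (2 * h))"
    using sum.lessThan_Suc_shift[of f "2 * h"] by (simp add: sum.distrib)
  also have "(\<Sum>i<2 * h. f i + f (Suc i)) \<le> (\<Sum>i<2 * h. 1)"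
    by (rule sum_mono) (use assms(1) in auto)
  finally show ?thesis using assms(2) by simp
qed

text \<open>Shifting the window by \<open>k\<close> loses only the first \<open>k\<close> terms,
  each at most \<open>1\<close>; the terms gained at the other end are nonnegative.\<close>

lemma sum_le_shifted_sum:
  fixes f :: "nat \<Rightarrow> nat"
  assumes "\<And>x. f x \<le> 1"
  shows "(\<Sum>x<M. f x) \<le> (\<Sum>x<M. f (x + k)) + k"
proof (induction k)
  case (Suc k)
  have "(\<Sum>x<M. f (x + k)) \<le> (\<Sum>x<Suc M. f (x + k))" by simp
  also have "\<dots> = f k + (\<Sum>x<M. f (x + Suc k))"
    by (subst sum.lessThan_Suc_shift) simp
  finally show ?case using Suc.IH assms[of k] by linarith
qed simp

text \<open>The cycle bound is summed over all starting points \<open>x \<le> N\<close>. Each of the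
  \<open>2 * h + 1\<close> shifted copies of the count costs a boundary term \<open>i * j\<close>
  independent of \<open>N\<close>, hence invisible in the density.\<close>

lemma counting_le_of_cycle:
  assumes S: "D_sequence D S" and D: "j \<in> D" "2 * h * j \<in> D"
  shows "(2 * h + 1) * counting S N \<le> (N + 1) * h + (\<Sum>i<Suc (2 * h). i * j)"
proof -
  define f :: "nat \<Rightarrow> nat" where "f x = of_bool (x \<in> S)" for x
  have f1: "f x \<le> 1" for x by (simp add: f_def)
  have conflict: "f x + f (x + d) \<le> 1" if "d \<in> D" for x d
    using D_sequenceD[OF S that, of x] by (simp add: f_def)
  have "(2 * h + 1) * counting S N = (\<Sum>i<Suc (2 * h). \<Sum>x<Suc N. f x)"
    by (simp add: counting_eq_sum f_def)
  also have "\<dots> \<le> (\<Sum>i<Suc (2 * h). (\<Sum>x<Suc N. f (x + i * j)) + i * j)"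
    by (intro sum_mono sum_le_shifted_sum f1)
  also have "\<dots> = (\<Sum>x<Suc N. \<Sum>i<Suc (2 * h). f (x + i * j)) + (\<Sum>i<Suc (2 * h). i * j)"
    by (subst sum.swap) (simp only: sum.distrib)
  also have "(\<Sum>x<Suc N. \<Sum>i<Suc (2 * h). f (x + i * j)) \<le> (\<Sum>x<Suc N. h)"
  proof (rule sum_mono, rule odd_cycle_independent_sum_le)
    fix x i
    show "f (x + i * j) + f (x + Suc i * j) \<le> 1"
      using conflict[OF D(1), of "x + i * j"] by (simp add: ac_simps)
    \<comment> \<open>The edge that closes the cycle comes from the long difference
      \<open>2 * h * j\<close>.\<close>
    show "f (x + 0 * j) + f (x + 2 * h * j) \<le> 1"
      using conflict[OF D(2), of x] by simp
  qed
  finally show ?thesis by simp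
qed

lemma seq_density_le_of_cycle:
  assumes S: "D_sequence D S" and D: "j \<in> D" "2 * h * j \<in> D"
  shows "seq_density S \<le> real h / (2 * real h + 1)"
proof -
  define K where "K = (\<Sum>i<Suc (2 * h). i * j)"
  let ?c = "real h / (2 * real h + 1)"
  let ?b = "\<lambda>N. ?c + real K / real (N + 1)"
  have le: "real (counting S N) / real (N + 1) \<le> ?b N" for N
  proof -
    have "real ((2 * h + 1) * counting S N) \<le> real ((N + 1) * h + K)"
      using counting_le_of_cycle[OF assms] unfolding K_def of_nat_le_iff by simp
    then have "real (counting S N) \<le> (real (N + 1) * real h + real K) / (2 * real h + 1)"
      by (simp add: field_simps)
    also have "\<dots> \<le> real (N + 1) * ?c + real K"
      by (simp add: divide_simps) (simp add: algebra_simps)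
    finally have "real (counting S N) / real (N + 1) \<le> (real (N + 1) * ?c + real K) / real (N + 1)"
      by (rule divide_right_mono) simp
    also have "\<dots> = ?b N" by (simp add: add_divide_distrib)
    finally show ?thesis .
  qed
  have "(\<lambda>N. real K / real (Suc N)) \<longlonglongrightarrow> 0"
    by (rule LIMSEQ_Suc[OF lim_const_over_n])
  then have "?b \<longlonglongrightarrow> ?c + 0" by (intro tendsto_intros) simp
  then have "limsup (\<lambda>N. ereal (?b N)) = ereal ?c"
    by (intro lim_imp_Limsup) simp_all
  moreover have "upper_density S \<le> limsup (\<lambda>N. ereal (?b N))"
    unfolding upper_density_def by (rule Limsup_mono) (use le in simp)
  ultimately have "upper_density S \<le> ereal ?c" by simp
  \<comment> \<open>The bound excludes \<open>\<infinity>\<close>; \<open>real_of_ereal\<close>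
    sends \<open>-\<infinity>\<close> to \<open>0\<close>, which is still at most
    \<open>?c\<close>.\<close>
  then show ?thesis unfolding seq_density_def by (cases "upper_density S") auto
qed

section \<open>Periodic sets: their densities and a dense construction\<close>

lemma sum_periodic_shift:
  fixes f :: "nat \<Rightarrow> nat"
  assumes "\<And>x. f (x + n) = f x"
  shows "(\<Sum>x<n. f (k + x)) = (\<Sum>x<n. f x)"
proof (induction k)
  case (Suc k)
  have "f k + (\<Sum>x<n. f (Suc k + x)) = (\<Sum>x<Suc n. f (k + x))"
    by (subst sum.lessThan_Suc_shift) simp
  also have "\<dots> = (\<Sum>x<n. f (k + x)) + f k" using assms by simp
  finally show ?case using Suc.IH by simp
qed simp

lemma sum_periodic_mult:
  fixes f :: "nat \<Rightarrow> nat"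
  assumes "\<And>x. f (x + n) = f x"
  shows "(\<Sum>x<q * n. f x) = q * (\<Sum>x<n. f x)"
proof (induction q)
  case (Suc q)
  have "(\<Sum>x<k + i. f x) = (\<Sum>x<k. f x) + (\<Sum>x<i. f (k + x))" for k i
    by (induction i) simp_all
  from this[of "q * n" n] show ?case
    using Suc.IH sum_periodic_shift[of f n "q * n", OF assms] by (simp add: add.commute)
qed simp

text \<open>With \<open>q = Suc N div n\<close>, the count lies between those of \<open>q\<close>
  and \<open>q + 1\<close> full periods, so it differs from \<open>(N + 1) * b / n\<close> by at
  most \<open>b\<close>, where \<open>b\<close> is the count in one period.\<close>

lemma periodic_density:
  assumes n: "n > 0" and per: "\<And>x. x + n \<in> S \<longleftrightarrow> x \<in> S"
  shows "has_density S" and "seq_density S = real (\<Sum>x<n. of_bool (x \<in> S)) / real n"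
proof -
  define f :: "nat \<Rightarrow> nat" where "f x = of_bool (x \<in> S)" for x
  define b where "b = (\<Sum>x<n. f x)"
  have fper: "f (x + n) = f x" for x using per by (simp add: f_def)
  have mono: "(\<Sum>x<M. f x) \<le> (\<Sum>x<M'. f x)" if "M \<le> M'" for M M'
    using that by (intro sum_mono2) auto
  have bounds: "real b / n - real b / (N + 1) \<le> counting S N / real (N + 1) \<and>
      counting S N / real (N + 1) \<le> real b / n + real b / (N + 1)" for N
  proof -
    define q where "q = Suc N div n"
    have q: "q * n \<le> Suc N" "Suc N \<le> Suc q * n"
      using dividend_less_div_times[OF n, of "Suc N"] by (simp_all add: q_def)
    have "q * b \<le> counting S N" "counting S N \<le> Suc q * b"
      using mono[OF q(1)] mono[OF q(2)] sum_periodic_mult[of f n, OF fper]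
      by (simp_all only: counting_eq_sum b_def f_def)
    then have c: "real q * b \<le> counting S N" "counting S N \<le> (real q + 1) * b"
      by (metis of_nat_le_iff of_nat_mult, metis of_nat_le_iff of_nat_mult of_nat_Suc add.commute)
    have r: "real q * n \<le> N + 1" "real N + 1 \<le> (real q + 1) * n"
      using q[folded of_nat_le_iff[where 'a = real]] by (simp_all add: algebra_simps)
    have "(real N + 1) / n - 1 \<le> q" "q \<le> (real N + 1) / n"
      using r n by (simp_all add: field_simps)
    then have "((real N + 1) / n - 1) * b \<le> real q * b" "(real q + 1) * b \<le> ((real N + 1) / n + 1) * b"
      by (auto intro!: mult_right_mono)
    with c have "((real N + 1) / n - 1) * b \<le> counting S N" "counting S N \<le> ((real N + 1) / n + 1) * b"
      by linarith+
    then have "((real N + 1) / n - 1) * b / (real N + 1) \<le> counting S N / (real N + 1)"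
        "counting S N / (real N + 1) \<le> ((real N + 1) / n + 1) * b / (real N + 1)"
      by (simp_all add: divide_right_mono)
    moreover have "(M / n - 1) * b / M = b / n - b / M" "(M / n + 1) * b / M = b / n + b / M"
      if "M > 0" for M :: real
      using n that by (simp_all add: field_simps)
    from this[of "real N + 1"]
    have "((real N + 1) / n - 1) * b / (real N + 1) = b / n - b / (real N + 1)"
        "((real N + 1) / n + 1) * b / (real N + 1) = b / n + b / (real N + 1)"
      by linarith+
    ultimately show ?thesis by (simp only: of_nat_add of_nat_1)
  qed
  have 0: "(\<lambda>N. real b / real (N + 1)) \<longlonglongrightarrow> 0"
    using LIMSEQ_Suc[OF lim_const_over_n[of "real b"]] by simp
  have "(\<lambda>N. counting S N / real (N + 1)) \<longlonglongrightarrow> real b / n"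
  proof (rule tendsto_sandwich)
    show "(\<lambda>N. real b / n - real b / real (N + 1)) \<longlonglongrightarrow> real b / n"
      using tendsto_diff[OF tendsto_const 0] by simp
    show "(\<lambda>N. real b / n + real b / real (N + 1)) \<longlonglongrightarrow> real b / n"
      using tendsto_add[OF tendsto_const 0] by simp
  qed (use bounds in \<open>auto simp: add.commute\<close>)
  then have lim: "(\<lambda>N. ereal (counting S N / real (N + 1))) \<longlonglongrightarrow> ereal (real b / n)"
    by simp
  have "upper_density S = ereal (real b / n)" "lower_density S = ereal (real b / n)"
    unfolding upper_density_def lower_density_def
    using lim_imp_Limsup[OF _ lim] lim_imp_Liminf[OF _ lim] by simp_all
  then show "has_density S" and "seq_density S = real (\<Sum>x<n. of_bool (x \<in> S)) / real n"
    by (simp_all add: has_density_def seq_density_def b_def f_def)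
qed

text \<open>The translate is chosen by averaging, since \<open>p\<close> and \<open>n\<close> need not be coprime.\<close>

lemma exists_dense_D_sequence:
  fixes n p a :: nat
  assumes n: "n > 0" and a: "a \<le> n"
    and D: "\<And>d. d \<in> D \<Longrightarrow> a \<le> p * d mod n \<and> p * d mod n + a \<le> n"
  obtains S where "D_sequence D S" "has_density S" "real a / real n \<le> seq_density S"
proof -
  define S where "S c = {x. (p * x + c) mod n < a}" for c
  have "D_sequence D (S c)" for c
  proof (rule D_sequenceI)
    fix x d assume d: "d \<in> D" and x: "x \<in> S c"
    let ?u = "(p * x + c) mod n" and ?w = "p * d mod n"
    have "(p * (x + d) + c) mod n = (?u + ?w) mod n"
      by (simp add: mod_add_eq algebra_simps)
    \<comment> \<open>No wrap-around occurs, since \<open>?u < a\<close> and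
      \<open>?w \<le> n - a\<close>. So \<open>?u + ?w\<close> is the residue for
      \<open>x + d\<close>, and \<open>?w \<ge> a\<close> puts it outside the interval.\<close>
    moreover have "?u + ?w < n" using x D[OF d] by (simp add: S_def)
    ultimately show "x + d \<notin> S c" using D[OF d] by (simp add: S_def)
  qed
  moreover have per: "x + n \<in> S c \<longleftrightarrow> x \<in> S c" for x c
  proof -
    have "(p * (x + n) + c) mod n = (p * x + c + p * n) mod n" by (simp add: algebra_simps)
    then show ?thesis by (simp add: S_def)
  qed
  moreover have "\<exists>c. a \<le> (\<Sum>x<n. of_bool (x \<in> S c))"
  proof (rule ccontr)
    assume "\<not> ?thesis"
    then have "(\<Sum>c<n. \<Sum>x<n. of_bool (x \<in> S c)) < (\<Sum>c<n. a)"
      using n by (intro sum_strict_mono) (auto simp: not_le)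
    \<comment> \<open>For fixed \<open>x\<close>, as \<open>c\<close> varies
      \<open>p * x + c\<close> meets every residue once, and exactly \<open>a\<close> residues are
      below \<open>a\<close>.\<close>
    moreover have "(\<Sum>c<n. of_bool (x \<in> S c)) = a" for x
    proof -
      have "(\<Sum>c<n. of_bool ((p * x + c) mod n < a)) = (\<Sum>c<n. of_bool (c mod n < a) :: nat)"
        by (rule sum_periodic_shift) simp
      also have "\<dots> = (\<Sum>c<n. of_bool (c < a))" by (rule sum.cong) auto
      also have "\<dots> = card ({..<n} \<inter> {..<a})" by (simp add: sum_of_bool_eq lessThan_def)
      also have "{..<n} \<inter> {..<a} = {..<a}" using a by auto
      finally show ?thesis by (simp add: S_def)
    qed
    then have "(\<Sum>x<n. \<Sum>c<n. of_bool (x \<in> S c)) = (\<Sum>x<n. a)" by simp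
    ultimately show False by (subst (asm) sum.swap) simp
  qed
  then obtain c where "a \<le> (\<Sum>x<n. of_bool (x \<in> S c))" by blast
  then have "real a / n \<le> seq_density (S c)"
    using n unfolding periodic_density(2)[OF n per]
    by (intro divide_right_mono) (simp_all only: of_nat_le_iff of_nat_0_le_iff)
  ultimately show thesis using that periodic_density(1)[OF n] by blast
qed

section \<open>Distances to the nearest integer\<close>

lemma dist_nearest_int_le: "dist_nearest_int x \<le> \<bar>x - of_int k\<bar>"
  using round_diff_minimal[of x k] by (simp add: dist_nearest_int_def)

text \<open>The fraction lies at least \<open>a / n\<close> away from both ends of the unit interval
  starting at \<open>w div n\<close>, hence from every integer, including the rounded value
  \<open>k\<close>.\<close>

lemma dist_nearest_int_fraction_ge:
  assumes n: "n > 0" and a: "a \<le> w mod n" "w mod n + a \<le> n"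
  shows "real a / real n \<le> dist_nearest_int (real w / real n)"
proof -
  define k where "k = round (real w / real n)"
  have "int a \<le> \<bar>int w - k * int n\<bar>"
  proof -
    define q where "q = int (w div n)"
    have w: "int w = q * int n + int (w mod n)"
      unfolding q_def by (metis div_mult_mod_eq of_nat_add of_nat_mult)
    show ?thesis
    proof (cases "k \<le> q")
      case True
      then have "k * int n \<le> q * int n" by (simp add: mult_right_mono)
      then show ?thesis using w a by linarith
    next
      case False
      then have "(q + 1) * int n \<le> k * int n" by (intro mult_right_mono) simp_all
      then show ?thesis using w a by (simp add: algebra_simps)
    qed
  qed
  then have "real_of_int (int a) \<le> real_of_int \<bar>int w - k * int n\<bar>" by (simp only: of_int_le_iff)
  then have "real a \<le> \<bar>real w - of_int k * real n\<bar>" by simp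
  also have "real w - of_int k * real n = (real w / n - of_int k) * n"
    using n by (simp add: left_diff_distrib)
  also have "\<bar>\<dots>\<bar> = \<bar>real w / n - of_int k\<bar> * n" by (simp add: abs_mult)
  finally show ?thesis using n by (simp add: dist_nearest_int_def k_def field_simps)
qed

lemma min_dist_nearest_int_le:
  "min (dist_nearest_int x) (dist_nearest_int (2 * real h * x)) \<le> real h / (2 * real h + 1)"
proof (rule ccontr)
  let ?c = "real h / (2 * real h + 1)"
  assume "\<not> ?thesis"
  then have x: "?c < dist_nearest_int x" and hx: "?c < dist_nearest_int (2 * real h * x)"
    by auto
  define k where "k = \<lfloor>x\<rfloor>"
  define e where "e = x - of_int k - 1 / 2"
  have "?c < \<bar>x - of_int k\<bar>" "?c < \<bar>x - of_int (k + 1)\<bar>"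
    using x dist_nearest_int_le[of x] by (blast intro: less_le_trans)+
  then have "?c < x - of_int k" "?c < of_int k + 1 - x"
    unfolding k_def by linarith+
  then have "\<bar>e\<bar> < 1 / 2 - ?c" by (simp add: e_def)
  then have "2 * real h * \<bar>e\<bar> \<le> 2 * real h * (1 / 2 - ?c)"
    by (intro mult_left_mono) simp_all
  \<comment> \<open>The threshold reproduces itself: \<open>1 / 2 - ?c\<close> equals
    \<open>1 / (2 * (2 * h + 1))\<close>.\<close>
  also have "\<dots> = ?c" by (simp add: field_simps)
  finally have "2 * real h * \<bar>e\<bar> \<le> ?c" .
  \<comment> \<open>Multiplying the half-integer \<open>k + 1 / 2\<close> by the even number
    \<open>2 * h\<close> gives an integer, so only the offset \<open>e\<close> contributes.\<close>
  moreover have "2 * real h * x - of_int (2 * int h * k + int h) = 2 * real h * e"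
    by (simp add: e_def algebra_simps)
  then have "dist_nearest_int (2 * real h * x) \<le> 2 * real h * \<bar>e\<bar>"
    using dist_nearest_int_le[of "2 * real h * x" "2 * int h * k + int h"] by (simp add: abs_mult)
  ultimately show False using hx by simp
qed

section \<open>Residues of the extremal multiplier and evaluation of both quantities\<close>

text \<open>Put \<open>a = 2 * h * l\<close>. The two larger differences land exactly on the ends
  \<open>a\<close> and \<open>n - a\<close>. For \<open>d = 1\<close> the residue is
  \<open>p\<close> itself, and \<open>p + a \<le> n\<close> amounts to
  \<open>h \<le> l\<close>.\<close>

lemma theorem5_residues:
  fixes h l :: nat
  assumes "0 < h" "h \<le> l" "d \<in> {1, 2 * l, 2 * h * (2 * l)}"
  defines "n \<equiv> (2 * h + 1) * (2 * l)" and "p \<equiv> h + (2 * h + 1) * l"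
  shows "2 * h * l \<le> p * d mod n \<and> p * d mod n + 2 * h * l \<le> n"
proof -
  have l: "l > 0" using assms by simp
  from assms(3) consider "d = 1" | "d = 2 * l" | "d = 2 * h * (2 * l)" by blast
  then show ?thesis
  proof cases
    case 1
    have "0 < h * l" using assms(1) l by simp
    then have "h + l + 2 * (h * l) < 2 * l + 4 * (h * l)" using assms(2) by linarith
    then have "p < n" by (simp add: n_def p_def algebra_simps)
    then show ?thesis using 1 assms(2) by (simp add: n_def p_def algebra_simps)
  next
    case 2
    have "p * d = 2 * h * l + l * n" by (simp add: 2 n_def p_def algebra_simps)
    moreover have "2 * h * l < n" using l by (simp add: n_def algebra_simps)
    ultimately have "p * d mod n = 2 * h * l" by simp
    then show ?thesis by (simp add: n_def algebra_simps)
  next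
    case 3
    \<comment> \<open>The quotient of \<open>p * d\<close> by \<open>n\<close> is
      \<open>2 * h * l + h - 1\<close>; the successor form avoids truncated subtraction.\<close>
    obtain g where g: "h = Suc g" using assms(1) gr0_implies_Suc by blast
    have "p * d = (2 * h * l + 2 * l) + (2 * h * l + g) * n"
      by (simp add: 3 n_def p_def g algebra_simps)
    moreover have "2 * h * l + 2 * l < n" using l assms(1) by (simp add: n_def algebra_simps)
    ultimately have "p * d mod n = 2 * h * l + 2 * l" by simp
    then show ?thesis by (simp add: n_def algebra_simps)
  qed
qed

theorem theorem5:
  fixes j m :: nat
  assumes "j > 0" and "m > 0" and "even j" and "even m" and "m \<le> j"
  shows "mu {1, j, m * j} = kappa {1, j, m * j}
    \<and> kappa {1, j, m * j} = real m / (2 * (real m + 1))"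
proof -
  obtain h l where m: "m = 2 * h" and j: "j = 2 * l" using assms by (auto elim!: evenE)
  have h: "0 < h" "h \<le> l" using assms m j by simp_all
  define D where "D = {1, j, m * j}"
  define n where "n = (2 * h + 1) * (2 * l)"
  define p where "p = h + (2 * h + 1) * l"
  define c where "c = real h / (2 * real h + 1)"
  have n: "n > 0" using h by (simp add: n_def)
  have an: "real (2 * h * l) / real n = c" 
  proof -
    have "real (2 * h * l) / real n = (2 * real l * real h) / (2 * real l * (2 * real h + 1))"
      by (simp add: n_def algebra_simps)
    also have "\<dots> = c" using h by (simp add: c_def del: mult.assoc)
    finally show ?thesis .
  qed
  have res: "2 * h * l \<le> p * d mod n \<and> p * d mod n + 2 * h * l \<le> n" if "d \<in> D" for d
    using theorem5_residues[OF h, of d] that by (simp add: D_def m j n_def p_def)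
  have mu: "mu D = c"
  proof -
    have le: "seq_density S \<le> c" if "D_sequence D S" for S
      using seq_density_le_of_cycle[OF that, of j h] by (simp add: D_def m c_def)
    obtain S where S: "D_sequence D S" "has_density S" "c \<le> seq_density S"
    proof (rule exists_dense_D_sequence[of n "2 * h * l" D p])
      show "2 * h * l \<le> n" by (simp add: n_def)
    qed (use n res an in auto)
    \<comment> \<open>The upper bound forces equality, so the supremum is attained at
      \<open>S\<close>.\<close>
    then have "seq_density S = c" using le by (simp add: antisym)
    with S le show ?thesis unfolding mu_def by (intro cSup_eq_maximum) auto
  qed
  have kappa: "kappa D = c"
    unfolding kappa_def
  proof (rule cSup_eq_maximum)
    have fin: "finite D" "D \<noteq> {}" by (simp_all add: D_def)
    have le: "Min ((\<lambda>d. dist_nearest_int (t * real d)) ` D) \<le> c" for t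
    proof -
      \<comment> \<open>With \<open>x = t * j\<close>, the entries for \<open>j\<close> and
        \<open>m * j\<close> are those of \<open>x\<close> and \<open>2 * h * x\<close>.\<close>
      have "Min ((\<lambda>d. dist_nearest_int (t * real d)) ` D)
          \<le> min (dist_nearest_int (t * j)) (dist_nearest_int (2 * real h * (t * j)))"
        using fin by (auto simp: D_def m ac_simps intro!: Min_le)
      also have "\<dots> \<le> c" unfolding c_def by (rule min_dist_nearest_int_le)
      finally show ?thesis .
    qed
    \<comment> \<open>The same \<open>p / n\<close> that produced the dense set attains the supremum
      over \<open>t\<close>.\<close>
    have "c \<le> Min ((\<lambda>d. dist_nearest_int (real p / real n * real d)) ` D)"
    proof (rule Min.boundedI)
      fix y assume "y \<in> (\<lambda>d. dist_nearest_int (real p / real n * real d)) ` D"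
      then obtain d where d: "d \<in> D" "y = dist_nearest_int (real (p * d) / real n)" by auto
      then show "c \<le> y" using dist_nearest_int_fraction_ge[OF n, of "2 * h * l" "p * d"] res[OF d(1)] an by simp
    qed (use fin in simp_all)
    then have "Min ((\<lambda>d. dist_nearest_int (real p / real n * real d)) ` D) = c"
      by (rule antisym[OF le])
    then show "c \<in> range (\<lambda>t. Min ((\<lambda>d. dist_nearest_int (t * real d)) ` D))"
      by (intro range_eqI[where x = "real p / real n"]) simp
    show "y \<le> c" if "y \<in> range (\<lambda>t. Min ((\<lambda>d. dist_nearest_int (t * real d)) ` D))" for y
      using that le by auto
  qed
  have "c = real m / (2 * (real m + 1))" using h by (simp add: c_def m field_simps)
  with mu kappa show ?thesis by (simp add: D_def)
qed

end
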